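(* Let $\operatorname{opt}$ be a choice function. If $\operatorname{norm}_{\operatorname{opt}}$ is subtree perfect, then $\operatorname{norm}_{\operatorname{opt}}(T)=\operatorname{back}_{\operatorname{opt}}(T)$ for every consistent decision tree $T$.
   Context: **Gambles.** $\Omega$ is a finite set (the possibility space); subsets of $\Omega$ are events. $\mathcal{R}$ is an arbitrary set of rewards. A gamble is a function $X\colon\Omega\to\mathcal{R}$. For an event $E$ and a gamble $X$, $EX$ is the restriction of $X$ to $E$, and $\oplus$ combines partial maps with disjoint domains: if $E_1,\dots,E_n$ is a partition of $\Omega$, $\bigoplus_{i=1}^n E_iX_i$ is the gamble that equals $X_i$ on each $E_i$. For sets of gambles, $\bigoplus_{i=1}^n E_i\mathcal{X}_i=\{\bigoplus_{i=1}^n E_iX_i\colon X_i\in\mathcal{X}_i\}$. **Choice functions.** A choice function $\operatorname{opt}$ maps every non-empty finite set $\mathcal{X}$ of gambles and every non-empty event $A$ to a set $\operatorname{opt}(\mathcal{X}|A)$ with $\emptyset\neq\operatorname{opt}(\mathcal{X}|A)\subseteq\mathcal{X}$. **Decision trees.** A decision tree is a finite rooted tree whose leaves carry rewards in $\mathcal{R}$ and whose other nodes are decision nodes or chance nodes; the arcs out of a chance node are labelled by events forming a finite partition of $\Omega$. Each tree $T$ carries an event $\operatorname{ev}(T)$ (the intersection of all events on chance arcs that have preceded $T$). $T=\bigsqcup_{i=1}^n T_i$ means the root of $T$ is a decision node with subtrees $T_i$ at its children; then $\operatorname{ev}(T_i)=\operatorname{ev}(T)$. $T=\bigodot_{i=1}^n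 E_iT_i$ means the root is a chance node with $T_i$ attached by the arc labelled $E_i$; then $\operatorname{ev}(T_i)=\operatorname{ev}(T)\cap E_i$. For a node $N$ of $T$, $\operatorname{st}_N(T)$ is the subtree of $T$ at $N$ (remove all non-descendants of $N$), with $\operatorname{ev}(\operatorname{st}_N(T))$ the intersection of $\operatorname{ev}(T)$ with all events on chance arcs on the path from the root of $T$ to $N$. $T$ is consistent if $\operatorname{ev}(\operatorname{st}_N(T))\neq\emptyset$ for every node $N$ of $T$. For a set $\mathcal{T}$ of trees, $\operatorname{st}_N(\mathcal{T})=\{\operatorname{st}_N(T)\colon T\in\mathcal{T},\ N\text{ in }T\}$. **Normal form.** A normal form decision of $T$ is a subtree of $T$ (with the same root, and $\operatorname{ev}$ unchanged) obtained by keeping exactly one arc out of each reached decision node and all arcs out of each reached chance node; its nodes are regarded as nodes of $T$. $\operatorname{nfd}(T)$ is the set of all normal form decisions of $T$. $\operatorname{gamb}(T)$ is defined recursively: $\{r\}$ (constant gamble) if $T$ is a leaf with reward $r$; $\operatorname{gamb}(\bigodot_{i} E_iT_i)=\bigoplus_{i} E_i\operatorname{gamb}(T_i)$; $\operatorname{gamb}(\bigsqcup_i T_i)=\bigcup_i\operatorname{gamb}(T_i)$. For a tree $T$ with $\operatorname{ev}(T)\neq\emptyset$, $$\operatorname{norm}_{\operatorname{opt}}(T)=\{U\in\operatorname{nfd}(T)\colon\operatorname{gamb}(U)\subseteq\operatorname{opt}(\operatorname{gamb}(T)|\operatorname{ev}(T))\}.$$ $\operatorname{norm}_{\operatorname{opt}}$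 is subtree perfect if for every consistent decision tree $T$ and every node $N$ which is in at least one element of $\operatorname{norm}_{\operatorname{opt}}(T)$, $\operatorname{st}_N(\operatorname{norm}_{\operatorname{opt}}(T))=\operatorname{norm}_{\operatorname{opt}}(\operatorname{st}_N(T))$. **Sets of trees.** For sets of trees, $\operatorname{gamb}(\mathcal{T})=\bigcup_{T\in\mathcal{T}}\operatorname{gamb}(T)$, $\operatorname{nfd}(\mathcal{T})=\bigcup_{T\in\mathcal{T}}\operatorname{nfd}(T)$, $\bigodot_i E_i\mathcal{T}_i=\{\bigodot_i E_iT_i\colon T_i\in\mathcal{T}_i\}$, $\bigsqcup_i\mathcal{T}_i=\{\bigsqcup_i T_i\colon T_i\in\mathcal{T}_i\}$. If $\mathcal{T}$ is a set of consistent trees with $\operatorname{ev}(T)=A$ for all $T\in\mathcal{T}$, then $\operatorname{norm}_{\operatorname{opt}}(\mathcal{T})=\{U\in\operatorname{nfd}(\mathcal{T})\colon\operatorname{gamb}(U)\subseteq\operatorname{opt}(\operatorname{gamb}(\mathcal{T})|A)\}$. **Backward induction operator.** For consistent $T$: $\operatorname{back}_{\operatorname{opt}}(T)=\{T\}$ if $T$ is a leaf; $\operatorname{back}_{\operatorname{opt}}(\bigodot_{i=1}^n E_iT_i)=\operatorname{norm}_{\operatorname{opt}}(\bigodot_{i=1}^n E_i\operatorname{back}_{\operatorname{opt}}(T_i))$; $\operatorname{back}_{\operatorname{opt}}(\bigsqcup_{i=1}^n T_i)=\operatorname{norm}_{\operatorname{opt}}(\bigsqcup_{i=1}^n\operatorname{back}_{\operatorname{opt}}(T_i))$.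 *)

theory Defs
  imports Main "HOL-Library.Disjoint_Sets"
begin

type_synonym ('w, 'r) gamble = "'w \<Rightarrow> 'r"

type_synonym ('w, 'r) choice = "('w, 'r) gamble set \<Rightarrow> 'w set \<Rightarrow> ('w, 'r) gamble set"

definition choice_function :: "('w, 'r) choice \<Rightarrow> bool" where
  "choice_function opt \<longleftrightarrow>
    (\<forall>X A. finite X \<and> X \<noteq> {} \<and> A \<noteq> {} \<longrightarrow> opt X A \<noteq> {} \<and> opt X A \<subseteq> X)"

text \<open>All ways of selecting one element from each set of a labelled family, keeping the labels.\<close>

definition selections :: "('k \<times> 'a set) list \<Rightarrow> ('k \<times> 'a) list set" where
  "selections F = (\<lambda>xs. zip (map fst F) xs) ` listset (map snd F)"

text \<open>The combination of gambles \<open>X\<^sub>i\<close> along events \<open>E\<^sub>i\<close>. The base case and the order of the list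
  are irrelevant when the events partition the possibility space; see \<open>oplus_eq\<close>.\<close>

fun oplus :: "('w set \<times> ('w, 'r) gamble) list \<Rightarrow> ('w, 'r) gamble" where
  "oplus [] = (\<lambda>_. undefined)"
| "oplus ((E, X) # F) = (\<lambda>\<omega>. if \<omega> \<in> E then X \<omega> else oplus F \<omega>)"

lemma oplus_eq:
  assumes "distinct (map fst F)" "disjoint (fst ` set F)" "(E, X) \<in> set F" "\<omega> \<in> E"
  shows "oplus F \<omega> = X \<omega>"
  using assms
proof (induction F rule: oplus.induct)
  case (2 E' X' F)
  show ?case
  proof (cases "(E, X) = (E', X')")
    case False
    then have mem: "(E, X) \<in> set F" using 2 by auto
    then have "E \<noteq> E'" using "2.prems"(1) by force
    then have "\<omega> \<notin> E'" using "2.prems" mem by (force simp: disjoint_def)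
    moreover have "disjoint (fst ` set F)"
      using "2.prems"(2) by (auto simp: disjoint_def)
    ultimately show ?thesis using 2 mem by auto
  qed (use 2 in auto)
qed auto

text \<open>Every node stores the event of the subtree rooted there. Arcs out of a decision node carry
  labels: a normal form decision keeps the label of the arc it retains, so that its nodes can be
  identified with nodes of the original tree even if several of the subtrees coincide.\<close>

datatype ('w, 'r) dtree =
    Leaf (ev: "'w set") 'r
  | Decision (ev: "'w set") "(nat \<times> ('w, 'r) dtree) list"
  | Chance (ev: "'w set") "('w set \<times> ('w, 'r) dtree) list"

fun decision_tree :: "('w, 'r) dtree \<Rightarrow> bool" where
  "decision_tree (Leaf A r) \<longleftrightarrow> True"
| "decision_tree (Decision A Ts) \<longleftrightarrow>
    Ts \<noteq> [] \<and> distinct (map fst Ts) \<and>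
    (\<forall>(i, T) \<in> set Ts. ev T = A \<and> decision_tree T)"
| "decision_tree (Chance A Ts) \<longleftrightarrow>
    distinct (map fst Ts) \<and> partition_on UNIV (fst ` set Ts) \<and>
    (\<forall>(E, T) \<in> set Ts. ev T = A \<inter> E \<and> decision_tree T)"

text \<open>A node is given by the sequence of arcs leading to it from the root.\<close>

datatype 'w arc = Choose nat | Event "'w set"

fun st :: "'w arc list \<Rightarrow> ('w, 'r) dtree \<Rightarrow> ('w, 'r) dtree option" where
  "st [] T = Some T"
| "st (Choose i # N) (Decision A Ts) = Option.bind (map_of Ts i) (\<lambda>T. st N T)"
| "st (Event E # N) (Chance A Ts) = Option.bind (map_of Ts E) (\<lambda>T. st N T)"
| "st _ _ = None"

definition nodes :: "('w, 'r) dtree \<Rightarrow> 'w arc list set" where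
  "nodes T = {N. st N T \<noteq> None}"

definition subtree :: "'w arc list \<Rightarrow> ('w, 'r) dtree \<Rightarrow> ('w, 'r) dtree" where
  "subtree N T = the (st N T)"

definition subtree_set :: "'w arc list \<Rightarrow> ('w, 'r) dtree set \<Rightarrow> ('w, 'r) dtree set" where
  "subtree_set N \<T> = {subtree N T |T. T \<in> \<T> \<and> N \<in> nodes T}"

lemma ev_subtree:
  assumes "decision_tree T" "N \<in> nodes T"
  shows "ev (subtree N T) = ev T \<inter> \<Inter>{E. Event E \<in> set N}"
  using assms
proof (induction N T rule: st.induct)
  case (2 i N A Ts)
  then obtain T where T: "map_of Ts i = Some T" "N \<in> nodes T"
    by (auto simp: nodes_def bind_eq_Some_conv)
  then have "ev T = A \<and> decision_tree T" using "2.prems" by (auto dest!: map_of_SomeD)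
  then show ?case using 2 T by (auto simp: subtree_def)
next
  case (3 E N A Ts)
  then obtain T where T: "map_of Ts E = Some T" "N \<in> nodes T"
    by (auto simp: nodes_def bind_eq_Some_conv)
  then have "ev T = A \<inter> E \<and> decision_tree T" using "3.prems" by (auto dest!: map_of_SomeD)
  then show ?case using 3 T by (auto simp: subtree_def)
qed (auto simp: nodes_def subtree_def)

definition consistent :: "('w, 'r) dtree \<Rightarrow> bool" where
  "consistent T \<longleftrightarrow> decision_tree T \<and> (\<forall>N \<in> nodes T. ev (subtree N T) \<noteq> {})"

fun gamb :: "('w, 'r) dtree \<Rightarrow> ('w, 'r) gamble set" where
  "gamb (Leaf A r) = {\<lambda>_. r}"
| "gamb (Decision A Ts) = (\<Union>(i, T) \<in> set Ts. gamb T)"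
| "gamb (Chance A Ts) = oplus ` selections (map (\<lambda>(E, T). (E, gamb T)) Ts)"

fun nfd :: "('w, 'r) dtree \<Rightarrow> ('w, 'r) dtree set" where
  "nfd (Leaf A r) = {Leaf A r}"
| "nfd (Decision A Ts) = (\<Union>(i, T) \<in> set Ts. {Decision A [(i, U)] |U. U \<in> nfd T})"
| "nfd (Chance A Ts) = Chance A ` selections (map (\<lambda>(E, T). (E, nfd T)) Ts)"

definition norm_opt :: "('w, 'r) choice \<Rightarrow> ('w, 'r) dtree \<Rightarrow> ('w, 'r) dtree set" where
  "norm_opt opt T = {U \<in> nfd T. gamb U \<subseteq> opt (gamb T) (ev T)}"

definition subtree_perfect :: "('w, 'r) choice \<Rightarrow> bool" where
  "subtree_perfect opt \<longleftrightarrow>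
    (\<forall>T N. consistent T \<and> (\<exists>U \<in> norm_opt opt T. N \<in> nodes U) \<longrightarrow>
      subtree_set N (norm_opt opt T) = norm_opt opt (subtree N T))"

definition gamb_set :: "('w, 'r) dtree set \<Rightarrow> ('w, 'r) gamble set" where
  "gamb_set \<T> = (\<Union>T \<in> \<T>. gamb T)"

definition nfd_set :: "('w, 'r) dtree set \<Rightarrow> ('w, 'r) dtree set" where
  "nfd_set \<T> = (\<Union>T \<in> \<T>. nfd T)"

text \<open>Here \<open>A\<close> is the common event of the trees in \<open>\<T>\<close>.\<close>

definition norm_opt_set ::
    "('w, 'r) choice \<Rightarrow> 'w set \<Rightarrow> ('w, 'r) dtree set \<Rightarrow> ('w, 'r) dtree set" where
  "norm_opt_set opt A \<T> = {U \<in> nfd_set \<T>. gamb U \<subseteq> opt (gamb_set \<T>) A}"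

fun back_opt :: "('w, 'r) choice \<Rightarrow> ('w, 'r) dtree \<Rightarrow> ('w, 'r) dtree set" where
  "back_opt opt (Leaf A r) = {Leaf A r}"
| "back_opt opt (Decision A Ts) =
    norm_opt_set opt A (Decision A ` selections (map (\<lambda>(i, T). (i, back_opt opt T)) Ts))"
| "back_opt opt (Chance A Ts) =
    norm_opt_set opt A (Chance A ` selections (map (\<lambda>(E, T). (E, back_opt opt T)) Ts))"

end

(*
  Every tree has the same gambles as the set of its normal form decisions, and each of these has a
  single gamble. Subtree perfection at a child of the root says that the restriction of an optimal
  decision to a child is optimal there, so the trees assembled from optimal decisions at the
  children still contain all of norm_opt T. It remains to see that opt makes the same choice from
  the gambles of any set S of decisions with norm_opt T \<subseteq> S \<subseteq> nfd T. For this, let the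
  subject first choose between T and a tree offering exactly the decisions in S: subtree perfection
  at the second option is the required independence property of opt.
*)
theory Submission imports Defs begin

section \<open>Selections from labelled families of sets\<close>

lemma selections_Nil [simp]: "selections [] = {[]}"
  by (simp add: selections_def)

lemma selections_Cons [simp]:
  "selections ((k, S) # F) = {(k, x) # xs |x xs. x \<in> S \<and> xs \<in> selections F}"
proof -
  have "set_Cons S X = (\<Union>x \<in> S. (#) x ` X)" for X
    by (auto simp: set_Cons_def)
  then show ?thesis by (auto simp: selections_def image_UN image_image)
qed

text \<open>Makes the relator theory of lists available: composition, monotonicity and congruence of
  \<open>list_all2\<close> replace inductions on the list of arcs.\<close>

lemma selections_iff_list_all2:
  "xs \<in> selections (map (\<lambda>(k, T). (k, f T)) Ts) \<longleftrightarrow>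
    list_all2 (\<lambda>(k, x) (k', T). k = k' \<and> x \<in> f T) xs Ts"
  by (induction Ts arbitrary: xs) (auto simp: list_all2_Cons2)

lemma finite_selections:
  assumes "\<And>k S. (k, S) \<in> set F \<Longrightarrow> finite S"
  shows "finite (selections F)"
  using assms
proof (induction F)
  case (Cons p F)
  obtain k S where p: "p = (k, S)" by fastforce
  have "selections (p # F) = (\<lambda>(x, xs). (k, x) # xs) ` (S \<times> selections F)"
    by (auto simp: p)
  moreover have "finite S" using Cons.prems[of k S] p by simp
  moreover have "finite (selections F)" using Cons.IH Cons.prems by (meson list.set_intros(2))
  ultimately show ?case by simp
qed simp

lemma selections_nonempty:
  assumes "\<And>k S. (k, S) \<in> set F \<Longrightarrow> S \<noteq> {}"
  shows "selections F \<noteq> {}"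
  using assms
proof (induction F)
  case (Cons p F)
  obtain k S where p: "p = (k, S)" by fastforce
  obtain x where "x \<in> S" using Cons.prems[of k S] p by auto
  moreover obtain xs where "xs \<in> selections F" using Cons by (metis all_not_in_conv list.set_intros(2))
  ultimately show ?case by (auto simp: p)
qed simp

text \<open>Selecting in two stages, first some \<open>U\<close> in \<open>h T\<close> and then an
  element of \<open>g U\<close>, reaches the same lists as selecting from the union at once, because
  \<open>list_all2\<close> commutes with relational composition. This handles both the gambles of
  decisions and the decisions of assembled trees at a chance node.\<close>

lemma selections_map_UN:
  fixes Ts :: "('a \<times> 'b) list" and g :: "'d \<Rightarrow> 'c set"
  assumes "\<And>k T. (k, T) \<in> set Ts \<Longrightarrow> f T = \<Union> (g ` h T)"
  shows "(\<Union>Us \<in> selections (map (\<lambda>(k, T). (k, h T)) Ts). selections (map (\<lambda>(k, U). (k, g U)) Us))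
    = selections (map (\<lambda>(k, T). (k, f T)) Ts)"
proof (rule set_eqI)
  fix xs
  define R :: "('b \<Rightarrow> 'c set) \<Rightarrow> 'a \<times> 'c \<Rightarrow> 'a \<times> 'b \<Rightarrow> bool"
    where "R f = (\<lambda>(k, x) (k', T). k = k' \<and> x \<in> f T)" for f
  define A :: "'a \<times> 'c \<Rightarrow> 'a \<times> 'd \<Rightarrow> bool" where "A = (\<lambda>(k, x) (k', U). k = k' \<and> x \<in> g U)"
  define B :: "'a \<times> 'd \<Rightarrow> 'a \<times> 'b \<Rightarrow> bool" where "B = (\<lambda>(k, U) (k', T). k = k' \<and> U \<in> h T)"
  have AB: "(A OO B) q p \<longleftrightarrow> R f q p" if "p \<in> set Ts" for p q
    using that assms[of "fst p" "snd p"] by (cases p; cases q) (auto simp: A_def B_def R_def relcompp_apply)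
  have "xs \<in> (\<Union>Us \<in> selections (map (\<lambda>(k, T). (k, h T)) Ts). selections (map (\<lambda>(k, U). (k, g U)) Us))
      \<longleftrightarrow> (list_all2 A OO list_all2 B) xs Ts"
    unfolding selections_iff_list_all2 UN_iff Bex_def A_def B_def relcompp_apply
    by (rule iff_exI) (rule conj_commute)
  also have "\<dots> \<longleftrightarrow> list_all2 (A OO B) xs Ts" by (simp only: list.rel_compp)
  also have "\<dots> \<longleftrightarrow> list_all2 (R f) xs Ts"
    by (rule list.rel_cong[OF refl refl]) (rule AB)
  also have "\<dots> \<longleftrightarrow> xs \<in> selections (map (\<lambda>(k, T). (k, f T)) Ts)"
    unfolding selections_iff_list_all2 R_def ..
  finally show "xs \<in> (\<Union>Us \<in> selections (map (\<lambda>(k, T). (k, h T)) Ts). selections (map (\<lambda>(k, U). (k, g U)) Us))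
      \<longleftrightarrow> xs \<in> selections (map (\<lambda>(k, T). (k, f T)) Ts)" .
qed

lemma selections_map_singleton:
  assumes "\<And>k T. (k, T) \<in> set Ts \<Longrightarrow> \<exists>x. f T = {x}"
  shows "\<exists>xs. selections (map (\<lambda>(k, T). (k, f T)) Ts) = {xs}"
  using assms
proof (induction Ts)
  case (Cons p Ts)
  obtain k T where p: "p = (k, T)" by fastforce
  obtain x where "f T = {x}" using Cons.prems[of k T] p by auto
  moreover obtain xs where "selections (map (\<lambda>(k, T). (k, f T)) Ts) = {xs}"
    using Cons.IH Cons.prems by (meson list.set_intros(2))
  ultimately show ?case by (simp add: p)
qed simp

lemma selections_mapD:
  assumes "xs \<in> selections (map (\<lambda>(k, T). (k, f T)) Ts)"
  shows "map fst xs = map fst Ts"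
    and "(k, x) \<in> set xs \<Longrightarrow> \<exists>T. (k, T) \<in> set Ts \<and> x \<in> f T"
proof -
  have *: "list_all2 (\<lambda>(k, x) (k', T). k = k' \<and> x \<in> f T) xs Ts"
    using assms by (simp add: selections_iff_list_all2)
  show "map fst xs = map fst Ts"
    using * by (induction rule: list_all2_induct) auto
  show "(k, x) \<in> set xs \<Longrightarrow> \<exists>T. (k, T) \<in> set Ts \<and> x \<in> f T"
    using * by (induction rule: list_all2_induct) auto
qed

text \<open>Start from any selection and overwrite the entry at the position of the arc
  \<open>(k, T)\<close>. It serves to complete an optimal decision at one child of a decision node
  to a choice at all children.\<close>

lemma selections_through:
  assumes "\<And>k T. (k, T) \<in> set Ts \<Longrightarrow> f T \<noteq> {}" and T: "(k, T) \<in> set Ts" and x: "x \<in> f T"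
  obtains xs where "xs \<in> selections (map (\<lambda>(k, T). (k, f T)) Ts)" "(k, x) \<in> set xs"
proof -
  let ?R = "\<lambda>(k, x) (k', T). k = k' \<and> x \<in> f T"
  have "selections (map (\<lambda>(k, T). (k, f T)) Ts) \<noteq> {}"
    by (rule selections_nonempty) (use assms(1) in auto)
  then obtain ys where ys: "list_all2 ?R ys Ts" unfolding selections_iff_list_all2[symmetric] by blast
  obtain n where n: "n < length Ts" "Ts ! n = (k, T)" using T by (metis in_set_conv_nth)
  have "list_all2 ?R (ys[n := (k, x)]) (Ts[n := (k, T)])"
    using ys x by (intro list_all2_update_cong) auto
  moreover have "Ts[n := (k, T)] = Ts" by (metis n(2) list_update_id)
  moreover have "n < length ys" using n(1) list_all2_lengthD[OF ys] by simp
  ultimately show thesis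
    using that[of "ys[n := (k, x)]"] set_update_memI[of n ys "(k, x)"]
    unfolding selections_iff_list_all2 by simp
qed

text \<open>Restates datatype induction with hypotheses indexed by arcs, in place of the components
  of pairs that the nested recursion produces.\<close>

lemma dtree_induct [case_names Leaf Decision Chance]:
  assumes "\<And>A r. P (Leaf A r)"
    and "\<And>A Ts. (\<And>i T. (i, T) \<in> set Ts \<Longrightarrow> P T) \<Longrightarrow> P (Decision A Ts)"
    and "\<And>A Ts. (\<And>E T. (E, T) \<in> set Ts \<Longrightarrow> P T) \<Longrightarrow> P (Chance A Ts)"
  shows "P T"
proof (induction T rule: dtree.induct)
  case (Leaf A r)
  show ?case by (rule assms(1))
next
  case (Decision A Ts)
  show ?case by (rule assms(2), erule Decision, simp)
next
  case (Chance A Ts)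
  show ?case by (rule assms(3), erule Chance, simp)
qed

section \<open>Gambles and normal form decisions of a tree\<close>

lemma finite_gamb: "finite (gamb T)"
proof (induction T rule: dtree_induct)
  case (Chance A Ts)
  have "finite (selections (map (\<lambda>(E, T). (E, gamb T)) Ts))"
    by (rule finite_selections) (use Chance in auto)
  then show ?case by simp
qed auto

lemma finite_nfd: "finite (nfd T)"
proof (induction T rule: dtree_induct)
  case (Decision A Ts)
  have "finite {Decision A [(i, U)] |U. U \<in> nfd T}" if "(i, T) \<in> set Ts" for i T
  proof -
    have "{Decision A [(i, U)] |U. U \<in> nfd T} = (\<lambda>U. Decision A [(i, U)]) ` nfd T" by auto
    then show ?thesis using Decision that by auto
  qed
  then show ?case by auto
next
  case (Chance A Ts)
  have "finite (selections (map (\<lambda>(E, T). (E, nfd T)) Ts))"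
    by (rule finite_selections) (use Chance in auto)
  then show ?case by simp
qed simp

lemma gamb_nonempty: "decision_tree T \<Longrightarrow> gamb T \<noteq> {}"
proof (induction T rule: dtree_induct)
  case (Decision A Ts)
  then obtain i T where "(i, T) \<in> set Ts" by (cases Ts) auto
  then show ?case using Decision by fastforce
next
  case (Chance A Ts)
  have "selections (map (\<lambda>(E, T). (E, gamb T)) Ts) \<noteq> {}"
    by (rule selections_nonempty) (use Chance in auto)
  then show ?case by simp
qed auto

text \<open>\<open>nfd\<close> and \<open>gamb\<close> follow the same recursion: a union over the
  arcs at decision nodes, and at chance nodes a selection, where the two stages merge by
  \<open>selections_map_UN\<close>.\<close>

lemma gamb_set_nfd: "gamb_set (nfd T) = gamb T"
proof (induction T rule: dtree_induct)
  case (Decision A Ts)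
  have "gamb_set (nfd (Decision A Ts)) = (\<Union>(i, T) \<in> set Ts. gamb_set (nfd T))"
  proof (intro equalityI subsetI)
    fix g assume "g \<in> (\<Union>(i, T) \<in> set Ts. gamb_set (nfd T))"
    then obtain i T U where U: "(i, T) \<in> set Ts" "U \<in> nfd T" "g \<in> gamb U"
      by (auto simp: gamb_set_def)
    then have "Decision A [(i, U)] \<in> nfd (Decision A Ts)" by auto
    moreover have "g \<in> gamb (Decision A [(i, U)])" using U(3) by simp
    ultimately show "g \<in> gamb_set (nfd (Decision A Ts))" unfolding gamb_set_def by blast
  qed (force simp: gamb_set_def)
  also have "\<dots> = gamb (Decision A Ts)"
    unfolding gamb.simps by (rule SUP_cong) (use Decision in auto)
  finally show ?case .
next
  case (Chance A Ts)
  have eq: "gamb T = \<Union> (gamb ` nfd T)" if "(E, T) \<in> set Ts" for E T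
    using Chance[OF that] by (simp add: gamb_set_def)
  have "gamb_set (nfd (Chance A Ts)) =
      oplus ` (\<Union>Us \<in> selections (map (\<lambda>(E, T). (E, nfd T)) Ts).
        selections (map (\<lambda>(E, U). (E, gamb U)) Us))"
    by (simp add: gamb_set_def image_UN)
  also have "(\<Union>Us \<in> selections (map (\<lambda>(E, T). (E, nfd T)) Ts).
        selections (map (\<lambda>(E, U). (E, gamb U)) Us)) =
      selections (map (\<lambda>(E, T). (E, gamb T)) Ts)"
    by (rule selections_map_UN) (rule eq)
  also have "oplus ` \<dots> = gamb (Chance A Ts)" by simp
  finally show ?case .
qed (simp add: gamb_set_def)

lemma gamb_set_nfd_set: "gamb_set (nfd_set \<T>) = gamb_set \<T>"
proof -
  have "gamb_set (nfd_set \<T>) = (\<Union>T \<in> \<T>. gamb_set (nfd T))"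
    by (auto simp: gamb_set_def nfd_set_def)
  then show ?thesis by (simp only: gamb_set_nfd gamb_set_def[of \<T>])
qed

lemma gamb_nfd_singleton: "U \<in> nfd T \<Longrightarrow> \<exists>g. gamb U = {g}"
proof (induction T arbitrary: U rule: dtree_induct)
  case (Decision A Ts)
  then obtain i T V where V: "(i, T) \<in> set Ts" "V \<in> nfd T" "U = Decision A [(i, V)]" by auto
  then show ?case using Decision.IH[OF V(1,2)] by simp
next
  case (Chance A Ts)
  then obtain Us where U: "U = Chance A Us" "Us \<in> selections (map (\<lambda>(E, T). (E, nfd T)) Ts)"
    by auto
  have "\<exists>g. gamb V = {g}" if V: "(E, V) \<in> set Us" for E V
    using selections_mapD(2)[OF U(2) V] Chance.IH by blast
  then obtain xs where "selections (map (\<lambda>(E, V). (E, gamb V)) Us) = {xs}"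
    using selections_map_singleton[of Us gamb] by blast
  then show ?case by (simp add: U)
qed auto

text \<open>The bridge between the two levels: \<open>opt\<close> selects gambles, while
  \<open>norm_opt\<close> selects decisions.\<close>

lemma gamb_obtain_nfd:
  assumes "g \<in> gamb T"
  obtains U where "U \<in> nfd T" "gamb U = {g}"
proof -
  obtain U where U: "U \<in> nfd T" "g \<in> gamb U"
    using assms unfolding gamb_set_nfd[of T, symmetric] gamb_set_def by blast
  then have "gamb U = {g}" using gamb_nfd_singleton[OF U(1)] by auto
  then show thesis using U(1) that by blast
qed

text \<open>No alternatives are left in a normal form decision. Backward induction forms decisions
  of trees built from decisions, and this shows that the children do not change again.\<close>

lemma nfd_idem: "U \<in> nfd T \<Longrightarrow> nfd U = {U}"
proof (induction T arbitrary: U rule: dtree_induct)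
  case (Decision A Ts)
  then obtain i T V where V: "(i, T) \<in> set Ts" "V \<in> nfd T" "U = Decision A [(i, V)]" by auto
  then show ?case using Decision.IH[OF V(1,2)] by simp
next
  case (Chance A Ts)
  then obtain Us where U: "U = Chance A Us" "Us \<in> selections (map (\<lambda>(E, T). (E, nfd T)) Ts)"
    by auto
  have *: "nfd V = {V}" if V: "(E, V) \<in> set Us" for E V
    using selections_mapD(2)[OF U(2) V] Chance.IH by blast
  then obtain xs where xs: "selections (map (\<lambda>(E, T). (E, nfd T)) Us) = {xs}"
    using selections_map_singleton[of Us nfd] by blast
  \<comment> \<open>The singleton is so far anonymous; exhibiting \<open>Us\<close> as a member
    identifies \<open>xs\<close> with \<open>Us\<close>.\<close>
  moreover have "Us \<in> selections (map (\<lambda>(E, T). (E, nfd T)) Us)"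
    unfolding selections_iff_list_all2 by (rule list.rel_refl_strong) (use * in auto)
  ultimately show ?case by (simp add: U)
qed auto

lemma ev_nfd: "U \<in> nfd T \<Longrightarrow> ev U = ev T"
  by (cases T) auto

section \<open>Nodes, subtrees and consistency\<close>

lemma nodes_Nil [simp]: "[] \<in> nodes T"
  by (simp add: nodes_def)

lemma subtree_Nil [simp]: "subtree [] T = T"
  by (simp add: subtree_def)

lemma consistent_ev:
  assumes "consistent T"
  shows "ev T \<noteq> {}"
proof -
  have "ev (subtree [] T) \<noteq> {}" using assms nodes_Nil unfolding consistent_def by blast
  then show ?thesis by simp
qed

lemma Choose_nodes [simp]:
  assumes "(i, T) \<in> set Ts" "distinct (map fst Ts)"
  shows "Choose i # N \<in> nodes (Decision A Ts) \<longleftrightarrow> N \<in> nodes T"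
    and "subtree (Choose i # N) (Decision A Ts) = subtree N T"
  using assms by (auto simp: nodes_def subtree_def)

lemma Event_nodes [simp]:
  assumes "(E, T) \<in> set Ts" "distinct (map fst Ts)"
  shows "Event E # N \<in> nodes (Chance A Ts) \<longleftrightarrow> N \<in> nodes T"
    and "subtree (Event E # N) (Chance A Ts) = subtree N T"
  using assms by (auto simp: nodes_def subtree_def)

text \<open>Replaces the quantification over all paths by a recursion: a node other than the root is
  a first arc followed by a node of the child.\<close>

lemma consistent_Decision:
  "consistent (Decision A Ts) \<longleftrightarrow>
    decision_tree (Decision A Ts) \<and> A \<noteq> {} \<and> (\<forall>(i, T) \<in> set Ts. consistent T)" (is "?L = ?R")
proof
  assume L: ?L
  then have d: "decision_tree (Decision A Ts)" by (simp add: consistent_def)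
  moreover have "A \<noteq> {}" using consistent_ev[OF L] by simp
  moreover have "consistent T" if T: "(i, T) \<in> set Ts" for i T
    unfolding consistent_def
  proof (intro conjI ballI)
    show "decision_tree T" using d T by auto
    fix N assume "N \<in> nodes T"
    then have "Choose i # N \<in> nodes (Decision A Ts)" using Choose_nodes(1) T d by fastforce
    then have "ev (subtree (Choose i # N) (Decision A Ts)) \<noteq> {}" using L by (simp add: consistent_def)
    then show "ev (subtree N T) \<noteq> {}" using Choose_nodes(2) T d by fastforce
  qed
  ultimately show ?R by auto
next
  assume R: ?R
  have "ev (subtree N (Decision A Ts)) \<noteq> {}" if "N \<in> nodes (Decision A Ts)" for N
  proof (cases N)
    case Nil
    then show ?thesis using R by simp
  next
    case (Cons a N')
    with that obtain i T where "a = Choose i" "map_of Ts i = Some T" "N' \<in> nodes T"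
      by (cases a) (auto simp: nodes_def bind_eq_Some_conv)
    then show ?thesis using R Cons
      by (fastforce simp: consistent_def subtree_def dest: map_of_SomeD)
  qed
  then show ?L using R unfolding consistent_def by blast
qed

lemma consistent_Chance:
  "consistent (Chance A Ts) \<longleftrightarrow>
    decision_tree (Chance A Ts) \<and> A \<noteq> {} \<and> (\<forall>(E, T) \<in> set Ts. consistent T)" (is "?L = ?R")
proof
  assume L: ?L
  then have d: "decision_tree (Chance A Ts)" by (simp add: consistent_def)
  moreover have "A \<noteq> {}" using consistent_ev[OF L] by simp
  moreover have "consistent T" if T: "(E, T) \<in> set Ts" for E T
    unfolding consistent_def
  proof (intro conjI ballI)
    show "decision_tree T" using d T by auto
    fix N assume "N \<in> nodes T"
    then have "Event E # N \<in> nodes (Chance A Ts)" using Event_nodes(1) T d by fastforce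
    then have "ev (subtree (Event E # N) (Chance A Ts)) \<noteq> {}" using L by (simp add: consistent_def)
    then show "ev (subtree N T) \<noteq> {}" using Event_nodes(2) T d by fastforce
  qed
  ultimately show ?R by auto
next
  assume R: ?R
  have "ev (subtree N (Chance A Ts)) \<noteq> {}" if "N \<in> nodes (Chance A Ts)" for N
  proof (cases N)
    case Nil
    then show ?thesis using R by simp
  next
    case (Cons a N')
    with that obtain E T where "a = Event E" "map_of Ts E = Some T" "N' \<in> nodes T"
      by (cases a) (auto simp: nodes_def bind_eq_Some_conv)
    then show ?thesis using R Cons
      by (fastforce simp: consistent_def subtree_def dest: map_of_SomeD)
  qed
  then show ?L using R unfolding consistent_def by blast
qed

text \<open>Allows normal form decisions to be used as the options of a new consistent decision
  node.\<close>

lemma consistent_nfd: "U \<in> nfd T \<Longrightarrow> consistent T \<Longrightarrow> consistent U"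
proof (induction T arbitrary: U rule: dtree_induct)
  case (Decision A Ts)
  then obtain i T V where U: "(i, T) \<in> set Ts" "V \<in> nfd T" "U = Decision A [(i, V)]" by auto
  have T: "consistent T" "ev T = A" "A \<noteq> {}"
    using Decision.prems(2) U(1) by (auto simp: consistent_Decision)
  have V: "consistent V" using Decision.IH[OF U(1,2) T(1)] .
  then have "decision_tree V" by (simp add: consistent_def)
  then show ?case using V T ev_nfd[OF U(2)] by (simp add: U(3) consistent_Decision)
next
  case (Chance A Ts)
  then obtain Us where U: "U = Chance A Us" "Us \<in> selections (map (\<lambda>(E, T). (E, nfd T)) Ts)"
    by auto
  have *: "consistent V \<and> decision_tree V \<and> ev V = A \<inter> E" if EV: "(E, V) \<in> set Us" for E V
  proof -
    obtain T where T: "(E, T) \<in> set Ts" "V \<in> nfd T" using selections_mapD(2)[OF U(2) EV] by blast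
    have "consistent T" "ev T = A \<inter> E"
      using Chance.prems(2) T(1) by (auto simp: consistent_Chance)
    then have "consistent V" "ev V = A \<inter> E" using Chance.IH[OF T] ev_nfd[OF T(2)] by simp_all
    then show ?thesis by (simp add: consistent_def)
  qed
  have fst: "map fst Us = map fst Ts" by (rule selections_mapD(1)[OF U(2)])
  \<comment> \<open>All chance arcs are kept, so their events still partition the possibility
    space.\<close>
  then have "fst ` set Us = fst ` set Ts" by (metis list.set_map)
  then have "decision_tree U" "A \<noteq> {}"
    using Chance.prems(2) * fst by (auto simp: U(1) consistent_Chance)
  then show ?case using * by (auto simp: U(1) consistent_Chance simp del: decision_tree.simps)
qed auto

section \<open>Consequences of subtree perfection\<close>

locale perfect_choice =
  fixes opt :: "('w, 'r) choice"
  assumes choice: "choice_function opt"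
    and perfect: "subtree_perfect opt"
begin

lemma opt_gamb:
  assumes "consistent T"
  shows "opt (gamb T) (ev T) \<noteq> {}" "opt (gamb T) (ev T) \<subseteq> gamb T"
proof -
  have "decision_tree T" using assms by (simp add: consistent_def)
  then show "opt (gamb T) (ev T) \<noteq> {}" "opt (gamb T) (ev T) \<subseteq> gamb T"
    using choice finite_gamb[of T] gamb_nonempty[of T] consistent_ev[OF assms]
    by (simp_all add: choice_function_def)
qed

lemma norm_opt_nonempty:
  assumes "consistent T"
  shows "norm_opt opt T \<noteq> {}"
proof -
  obtain g where "g \<in> opt (gamb T) (ev T)" "g \<in> gamb T" using opt_gamb[OF assms] by blast
  moreover from this obtain U where "U \<in> nfd T" "gamb U = {g}" using gamb_obtain_nfd by blast
  ultimately have "U \<in> norm_opt opt T" by (simp add: norm_opt_def)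
  then show ?thesis by blast
qed

lemma subtree_norm_opt:
  assumes "consistent T" "U \<in> norm_opt opt T" "N \<in> nodes U"
  shows "subtree N U \<in> norm_opt opt (subtree N T)"
proof -
  have "subtree_set N (norm_opt opt T) = norm_opt opt (subtree N T)"
    using assms perfect unfolding subtree_perfect_def by blast
  moreover have "subtree N U \<in> subtree_set N (norm_opt opt T)"
    using assms(2,3) unfolding subtree_set_def by blast
  ultimately show ?thesis by blast
qed

text \<open>This is Arrow's choice axiom for gamble sets of consistent trees with a common event. A
  decision node offering both \<open>T\<close> and \<open>T'\<close> has no gambles beyond those of
  \<open>T\<close>. An optimal gamble available in \<open>T'\<close> puts the node of
  \<open>T'\<close> into an optimal decision, so subtree perfection applies there.\<close>

lemma opt_gamb_Int:
  assumes T: "consistent T" and T': "consistent T'" and ev: "ev T' = ev T"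
    and sub: "gamb T' \<subseteq> gamb T" and ne: "opt (gamb T) (ev T) \<inter> gamb T' \<noteq> {}"
  shows "opt (gamb T') (ev T) = opt (gamb T) (ev T) \<inter> gamb T'"
proof -
  \<comment> \<open>The distinct labels keep the two options apart as nodes even when
    \<open>T\<close> and \<open>T'\<close> coincide.\<close>
  define S where "S = Decision (ev T) [(0, T), (1, T')]"
  have S: "consistent S" "subtree [Choose 1] S = T'"
    using T T' ev consistent_ev[OF T]
    by (auto simp: S_def consistent_Decision subtree_def) (auto simp: consistent_def)
  have gS: "gamb S = gamb T" "ev S = ev T" using sub by (auto simp: S_def)
  have eq: "U \<in> norm_opt opt T' \<longleftrightarrow> gamb U \<subseteq> opt (gamb T) (ev T)" if "U \<in> nfd T'" for U
  proof -
    let ?N = "[Choose 1]"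
    \<comment> \<open>The decision \<open>V\<close> with gamble \<open>h\<close> will show that the
      node \<open>?N\<close> occurs in an optimal decision of \<open>S\<close>.\<close>
    obtain h where h: "h \<in> opt (gamb T) (ev T)" "h \<in> gamb T'" using ne by auto
    obtain V where V: "V \<in> nfd T'" "gamb V = {h}" using gamb_obtain_nfd[OF h(2)] .
    have 1: "Decision (ev T) [(1, W)] \<in> norm_opt opt S \<longleftrightarrow> gamb W \<subseteq> opt (gamb T) (ev T)"
      if "W \<in> nfd T'" for W
      using that unfolding norm_opt_def gS by (auto simp: S_def)
    have "?N \<in> nodes (Decision (ev T) [(1, V)])" by (simp add: nodes_def)
    then have "subtree_set ?N (norm_opt opt S) = norm_opt opt T'"
      using perfect S 1[OF V(1)] h V(2) unfolding subtree_perfect_def by (metis empty_subsetI insert_subset)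
    moreover have "subtree_set ?N (norm_opt opt S) = {W \<in> nfd T'. gamb W \<subseteq> opt (gamb T) (ev T)}"
      (is "?A = ?B")
    proof
      show "?B \<subseteq> ?A"
      proof
        fix W assume "W \<in> ?B"
        then have "Decision (ev T) [(1, W)] \<in> norm_opt opt S" using 1 by blast
        moreover have "?N \<in> nodes (Decision (ev T) [(1, W)])"
          "W = subtree ?N (Decision (ev T) [(1, W)])"
          by (simp_all add: nodes_def subtree_def)
        ultimately show "W \<in> ?A" unfolding subtree_set_def by blast
      qed
      show "?A \<subseteq> ?B"
      proof
        fix W assume "W \<in> ?A"
        then obtain X where X: "X \<in> norm_opt opt S" "?N \<in> nodes X" "W = subtree ?N X"
          by (auto simp: subtree_set_def)
        \<comment> \<open>A decision that retains the arc labelled 0 does not contain the node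
          \<open>?N\<close>.\<close>
        then have "X = Decision (ev T) [(1, W)]" "W \<in> nfd T'"
          by (auto simp: norm_opt_def S_def nodes_def subtree_def)
        then show "W \<in> ?B" using 1 X by blast
      qed
    qed
    ultimately show ?thesis using that by auto
  qed
  have "g \<in> opt (gamb T') (ev T) \<longleftrightarrow> g \<in> opt (gamb T) (ev T)" if g: "g \<in> gamb T'" for g
  proof -
    obtain U where "U \<in> nfd T'" "gamb U = {g}" using gamb_obtain_nfd[OF g] .
    then show ?thesis using eq[of U] by (auto simp: norm_opt_def ev)
  qed
  then show ?thesis using opt_gamb(2)[OF T'] ev by auto
qed

text \<open>The lower bound on the decisions of \<T> keeps every optimal gamble and the upper bound
  admits no new one, so Arrow's axiom leaves the choice unchanged. The members of \<T> enter only
  through their decisions.\<close>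

lemma norm_opt_set_eq_norm_opt:
  assumes T: "consistent T" and "norm_opt opt T \<subseteq> nfd_set \<T>" and sub: "nfd_set \<T> \<subseteq> nfd T"
  shows "norm_opt_set opt (ev T) \<T> = norm_opt opt T"
proof -
  have "finite (nfd_set \<T>)" using sub finite_nfd finite_subset by blast
  then obtain Us where Us: "set Us = nfd_set \<T>" using finite_list by blast
  have ne: "nfd_set \<T> \<noteq> {}" using assms norm_opt_nonempty[OF T] by blast
  \<comment> \<open>Subtree perfection concerns single trees, so the decisions of \<T> become the
    options of one decision node; \<open>enumerate\<close> supplies distinct labels.\<close>
  define T' where "T' = Decision (ev T) (enumerate 0 Us)"
  have snd: "snd ` set (enumerate 0 Us) = nfd_set \<T>"
    unfolding Us[symmetric] list.set_map[symmetric] by simp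
  have "gamb T' = (\<Union>U \<in> snd ` set (enumerate 0 Us). gamb U)"
    by (simp add: T'_def case_prod_beta image_image)
  also have "\<dots> = gamb_set (nfd_set \<T>)" by (simp only: snd gamb_set_def)
  also have "\<dots> = gamb_set \<T>" by (rule gamb_set_nfd_set)
  finally have gT': "gamb T' = gamb_set \<T>" .
  have *: "consistent U \<and> decision_tree U \<and> ev U = ev T" if "(i, U) \<in> set (enumerate 0 Us)" for i U
  proof -
    have "U \<in> nfd T" using that snd sub by force
    then have "consistent U" "ev U = ev T" using consistent_nfd[OF _ T] ev_nfd by blast+
    then show ?thesis by (simp add: consistent_def)
  qed
  have "enumerate 0 Us \<noteq> []" using snd ne by force
  moreover have "distinct (map fst (enumerate 0 Us))" by simp
  ultimately have T': "consistent T'" "ev T' = ev T"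
    using * consistent_ev[OF T] by (auto simp: T'_def consistent_Decision)
  have "gamb_set (nfd_set \<T>) \<subseteq> gamb_set (nfd T)" using sub by (auto simp: gamb_set_def)
  then have "gamb T' \<subseteq> gamb T" by (simp add: gT' gamb_set_nfd gamb_set_nfd_set)
  moreover have "opt (gamb T) (ev T) \<subseteq> gamb T'"
  proof
    fix g assume g: "g \<in> opt (gamb T) (ev T)"
    then obtain U where U: "U \<in> nfd T" "gamb U = {g}"
      using gamb_obtain_nfd opt_gamb(2)[OF T] by blast
    then have "U \<in> norm_opt opt T" using g by (simp add: norm_opt_def)
    then have "U \<in> nfd_set \<T>" using assms(2) by blast
    then have "g \<in> gamb_set (nfd_set \<T>)" using U unfolding gamb_set_def by blast
    then show "g \<in> gamb T'" by (simp add: gT' gamb_set_nfd_set)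
  qed
  \<comment> \<open>The optimal gambles of \<open>T\<close> are nonempty and all lie in
    \<open>gamb T'\<close>, so intersecting with \<open>gamb T'\<close> removes nothing.\<close>
  ultimately have "opt (gamb_set \<T>) (ev T) = opt (gamb T) (ev T)"
    using opt_gamb_Int[OF T T'] opt_gamb(1)[OF T] gT' by auto
  then show ?thesis using assms by (auto simp: norm_opt_set_def norm_opt_def)
qed

text \<open>The induction hypothesis turns \<open>back_opt\<close> at the children into
  \<open>norm_opt\<close>. Each inner node then needs only the two inclusions required by
  \<open>norm_opt_set_eq_norm_opt\<close>.\<close>

lemma norm_opt_eq_back_opt: "consistent T \<Longrightarrow> norm_opt opt T = back_opt opt T"
proof (induction T rule: dtree_induct)
  case (Leaf A r)
  then show ?case using norm_opt_nonempty[OF Leaf] by (auto simp: norm_opt_def)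
next
  case (Decision A Ts)
  let ?T = "Decision A Ts"
  let ?sel = "selections (map (\<lambda>(i, T). (i, norm_opt opt T)) Ts)"
  have d: "distinct (map fst Ts)" using Decision.prems by (simp add: consistent_Decision)
  have con: "consistent T" if "(i, T) \<in> set Ts" for i T
    using Decision.prems that by (auto simp: consistent_Decision)
  have nfd: "V \<in> nfd T" if "V \<in> norm_opt opt T" for V T using that by (simp add: norm_opt_def)
  have IH: "map (\<lambda>(i, T). (i, back_opt opt T)) Ts = map (\<lambda>(i, T). (i, norm_opt opt T)) Ts"
  proof (rule map_cong[OF refl])
    fix p assume "p \<in> set Ts"
    moreover obtain i T where p: "p = (i, T)" by fastforce
    ultimately have "norm_opt opt T = back_opt opt T" using Decision.IH[of i T] con[of i T] by simp
    then show "(case p of (i, T) \<Rightarrow> (i, back_opt opt T)) = (case p of (i, T) \<Rightarrow> (i, norm_opt opt T))"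
      by (simp add: p)
  qed
  have "nfd_set (Decision A ` ?sel) \<subseteq> nfd ?T"
  proof
    fix U assume "U \<in> nfd_set (Decision A ` ?sel)"
    then obtain Us i V W where U: "Us \<in> ?sel" "(i, V) \<in> set Us" "W \<in> nfd V" "U = Decision A [(i, W)]"
      by (auto simp: nfd_set_def)
    then obtain T where T: "(i, T) \<in> set Ts" "V \<in> norm_opt opt T"
      using selections_mapD(2)[OF U(1,2)] by blast
    \<comment> \<open>\<open>V\<close> is already a normal form decision, so \<open>W\<close> is
      \<open>V\<close> itself.\<close>
    then have "W \<in> nfd T" using nfd_idem[OF nfd[OF T(2)]] U(3) nfd by simp
    then show "U \<in> nfd ?T" using T(1) U(4) by auto
  qed
  moreover have "norm_opt opt ?T \<subseteq> nfd_set (Decision A ` ?sel)"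
  proof
    fix U assume U: "U \<in> norm_opt opt ?T"
    then obtain i T V where V: "(i, T) \<in> set Ts" "V \<in> nfd T" "U = Decision A [(i, V)]"
      by (auto simp: norm_opt_def)
    have "V \<in> norm_opt opt T"
      using subtree_norm_opt[OF Decision.prems U, of "[Choose i]"] V d by simp
    \<comment> \<open>An assembled tree needs an optimal decision at every child, although
      \<open>U\<close> provides one only along the arc \<open>i\<close>.\<close>
    moreover have "norm_opt opt T' \<noteq> {}" if "(j, T') \<in> set Ts" for j T'
      using norm_opt_nonempty[OF con[OF that]] .
    ultimately obtain Us where "Us \<in> ?sel" "(i, V) \<in> set Us"
      using selections_through[of Ts "norm_opt opt" i T V] V(1) by blast
    moreover have "V \<in> nfd V" using nfd_idem[OF V(2)] by simp
    ultimately have "U \<in> nfd (Decision A Us)" "Us \<in> ?sel"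
      using V(3) by auto
    then show "U \<in> nfd_set (Decision A ` ?sel)" unfolding nfd_set_def by blast
  qed
  ultimately have "norm_opt_set opt (ev ?T) (Decision A ` ?sel) = norm_opt opt ?T"
    using norm_opt_set_eq_norm_opt[OF Decision.prems] by blast
  then show ?case by (simp add: IH)
next
  case (Chance A Ts)
  let ?T = "Chance A Ts"
  let ?sel = "selections (map (\<lambda>(E, T). (E, norm_opt opt T)) Ts)"
  have d: "distinct (map fst Ts)" using Chance.prems by (simp add: consistent_Chance)
  have con: "consistent T" if "(E, T) \<in> set Ts" for E T
    using Chance.prems that by (auto simp: consistent_Chance)
  have nfd: "V \<in> nfd T" if "V \<in> norm_opt opt T" for V T using that by (simp add: norm_opt_def)
  have IH: "map (\<lambda>(E, T). (E, back_opt opt T)) Ts = map (\<lambda>(E, T). (E, norm_opt opt T)) Ts"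
  proof (rule map_cong[OF refl])
    fix p assume "p \<in> set Ts"
    moreover obtain E T where p: "p = (E, T)" by fastforce
    ultimately have "norm_opt opt T = back_opt opt T" using Chance.IH[of E T] con[of E T] by simp
    then show "(case p of (E, T) \<Rightarrow> (E, back_opt opt T)) = (case p of (E, T) \<Rightarrow> (E, norm_opt opt T))"
      by (simp add: p)
  qed
  have "nfd_set (Chance A ` ?sel) =
      Chance A ` (\<Union>Us \<in> ?sel. selections (map (\<lambda>(E, U). (E, nfd U)) Us))"
    by (simp add: nfd_set_def image_UN)
  \<comment> \<open>At a chance node the trees assembled from decisions are themselves normal form
    decisions.\<close>
  also have "(\<Union>Us \<in> ?sel. selections (map (\<lambda>(E, U). (E, nfd U)) Us)) = ?sel"
  proof (rule selections_map_UN)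
    show "norm_opt opt T = \<Union> (nfd ` norm_opt opt T)" for T
      using nfd_idem[OF nfd] by auto
  qed
  finally have eq: "nfd_set (Chance A ` ?sel) = Chance A ` ?sel" .
  have "?sel \<subseteq> selections (map (\<lambda>(E, T). (E, nfd T)) Ts)"
  proof
    fix Us assume "Us \<in> ?sel"
    then show "Us \<in> selections (map (\<lambda>(E, T). (E, nfd T)) Ts)"
      unfolding selections_iff_list_all2 by (rule list_all2_mono) (use nfd in auto)
  qed
  then have "nfd_set (Chance A ` ?sel) \<subseteq> nfd ?T" by (auto simp: eq)
  moreover have "norm_opt opt ?T \<subseteq> nfd_set (Chance A ` ?sel)"
  proof
    fix U assume U: "U \<in> norm_opt opt ?T"
    then obtain Us where Us: "Us \<in> selections (map (\<lambda>(E, T). (E, nfd T)) Ts)" "U = Chance A Us"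
      by (auto simp: norm_opt_def)
    have d': "distinct (map fst Us)" using d selections_mapD(1)[OF Us(1)] by simp
    \<comment> \<open>\<open>U\<close> contains every child of the chance node, so subtree
      perfection applies along each arc and all of its children are optimal.\<close>
    have *: "V \<in> norm_opt opt T" if "(E, V) \<in> set Us" "(E, T) \<in> set Ts" for E V T
      using subtree_norm_opt[OF Chance.prems U, of "[Event E]"] that d d' by (simp add: Us)
    have "Us \<in> ?sel"
      using Us(1) unfolding selections_iff_list_all2 by (rule list.rel_mono_strong) (use * in auto)
    then show "U \<in> nfd_set (Chance A ` ?sel)" by (simp add: eq Us)
  qed
  ultimately have "norm_opt_set opt (ev ?T) (Chance A ` ?sel) = norm_opt opt ?T"
    using norm_opt_set_eq_norm_opt[OF Chance.prems] by blast
  then show ?case by (simp add: IH)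
qed

end

theorem corollary27:
  fixes opt :: "('w :: finite, 'r) choice"
  assumes "choice_function opt"
    and "subtree_perfect opt"
  shows "\<forall>T. consistent T \<longrightarrow> norm_opt opt T = back_opt opt T"
  using assms perfect_choice.norm_opt_eq_back_opt perfect_choice.intro by blast

end
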